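(* (Soundness of $QLET_F$.) Let $\mathcal{S}$ be a signature and let $\Gamma\cup\{A\}\subseteq Sent(\mathcal{S})$. If $\Gamma\vdash A$ in $QLET_F$, then $\Gamma\vDash A$.
   Context: **Language.** A signature is a pair $\mathcal{S}=\langle\mathcal{C},\mathcal{P}\rangle$, where $\mathcal{C}$ is an infinite set of individual constants and $\mathcal{P}$ is a set of predicate letters, each of finite arity, containing a binary identity predicate $\approx$. The logical symbols are the unary connectives $\neg,\circ,\bullet$, the binary connectives $\land,\lor$, the quantifiers $\forall,\exists$, and variables $\mathcal{V}=\{v_i:i\in\mathbb{N}\}$. Terms are variables and constants (no function symbols). Formulas are defined as usual, except that void quantifiers are not allowed: $\forall xB$ and $\exists xB$ are formulas only if $x$ is free in $B$. $Form(\mathcal{S})$ and $Sent(\mathcal{S})$ are the sets of formulas and of sentences (closed formulas). $A(t/x)$ is the result of replacing every free occurrence of $x$ in $A$ by $t$. Two formulas are alphabetic variants if they differ only in (some of) their bound variables. **Natural deduction system $QLET_F$** (over sentences of $\mathcal{S}$; $c,c_1,c_2\in\mathcal{C}$; wherever $A(c/x)$ occurs, $A$ is a formula with no free variable other than $x$; square brackets mark discharged hypotheses): - $\land I$: from $A$, $B$ infer $A\land B$. $\land E$: from $A\land B$ infer $A$; from $A\land B$ infer $B$. - $\lor I$: from $A$ infer $A\lor B$; from $B$ infer $A\lor B$. $\lor E$: from $A\lor B$, a derivation of $C$ from $[A]$ and a derivation of $C$ from $[B]$, infer $C$. - $\neg\land I$: from $\neg A$ infer $\neg(A\land B)$; from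 $\neg B$ infer $\neg(A\land B)$. $\neg\land E$: from $\neg(A\land B)$, a derivation of $C$ from $[\neg A]$ and a derivation of $C$ from $[\neg B]$, infer $C$. - $\neg\lor I$: from $\neg A$, $\neg B$ infer $\neg(A\lor B)$. $\neg\lor E$: from $\neg(A\lor B)$ infer $\neg A$; from $\neg(A\lor B)$ infer $\neg B$. - $DN$: from $A$ infer $\neg\neg A$; from $\neg\neg A$ infer $A$. - $EXP^{\circ}$: from $\circ A$, $A$, $\neg A$ infer $B$. $PEM^{\circ}$: from $\circ A$ infer $A\lor\neg A$. - $Cons$: from $\circ A$, $\bullet A$ infer $B$. $Comp$: infer $\circ A\lor\bullet A$ from no premises. - $\forall I$: from $B\lor A(c/x)$ infer $B\lor\forall xA$, provided $c$ occurs neither in $A$ or $B$ nor in any hypothesis on which $B\lor A(c/x)$ depends. $\forall E$: from $\forall xA$ infer $A(c/x)$. - $\exists I$: from $A(c/x)$ infer $\exists xA$. $\exists E$: from $\exists xA$ and a derivation of $C$ from $[A(c/x)]$ infer $C$, provided $c$ occurs neither in $A$ or $C$ nor in any hypothesis on which $C$ depends, except $A(c/x)$. - $\neg\forall I$: from $\neg A(c/x)$ infer $\neg\forall xA$. $\neg\forall E$: from $\neg\forall xA$ and a derivation of $C$ from $[\neg A(c/x)]$ infer $C$, provided $c$ occurs neither in $A$ or $C$ nor in any hypothesis on which $C$ depends, except $\neg A(c/x)$. - $\neg\exists I$: from $\neg A(c/x)$ infer $\neg\exists xA$, provided $c$ occurs neither in $A$ nor in any hypothesis on which $\neg A(c/x)$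 depends. $\neg\exists E$: from $\neg\exists xA$ infer $\neg A(c/x)$. - $\approx I$: infer $c\approx c$ from no premises. $\approx E$: from $c_1\approx c_2$ and $A(c_1/x)$ infer $A(c_2/x)$. - $AV$: from $A$ infer $A'$, for any alphabetic variant $A'$ of $A$. $\Gamma\vdash A$ (or $\Gamma\vdash_{\mathcal S}A$) means there is a (finite, tree-shaped) derivation of $A$ all of whose undischarged hypotheses belong to $\Gamma$. **Semantics.** An $\mathcal{S}$-structure is a pair $\mathfrak{A}=\langle\mathcal{D},\mathcal{I}\rangle$ with $\mathcal{D}\neq\emptyset$ such that $\mathcal{I}(c)=c^{\mathfrak{A}}\in\mathcal{D}$ for each $c\in\mathcal{C}$; each $n$-ary $P\in\mathcal{P}$ is assigned a pair $\langle P_+^{\mathfrak{A}},P_-^{\mathfrak{A}}\rangle$ with $P_+^{\mathfrak{A}}\cup P_-^{\mathfrak{A}}\subseteq\mathcal{D}^n$; and $\approx_+^{\mathfrak{A}}=\{\langle a,a\rangle:a\in\mathcal{D}\}$ (no constraint on $\approx_-^{\mathfrak A}$). The diagram signature $\mathcal{S}_{\mathfrak{A}}=\langle\mathcal{C}_{\mathfrak{A}},\mathcal{P}\rangle$ adds a new constant $\overline{a}$ for each $a\in\mathcal{D}$, i.e. $\mathcal{C}_{\mathfrak{A}}=\mathcal{C}\cup\{\overline{a}:a\in\mathcal{D}\}$; $\widehat{\mathfrak{A}}$ is the $\mathcal{S}_{\mathfrak{A}}$-structure that is just like $\mathfrak{A}$ except that $\overline{a}^{\widehat{\mathfrak{A}}}=a$.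 A map $v:Sent(\mathcal{S}_{\mathfrak{A}})\to\{0,1\}$ is an $\mathfrak{A}$-valuation if: 1. $v(P(c_1,\dots,c_n))=1$ iff $\langle c_1^{\widehat{\mathfrak{A}}},\dots,c_n^{\widehat{\mathfrak{A}}}\rangle\in P_+^{\mathfrak{A}}$; 2. $v(\neg P(c_1,\dots,c_n))=1$ iff $\langle c_1^{\widehat{\mathfrak{A}}},\dots,c_n^{\widehat{\mathfrak{A}}}\rangle\in P_-^{\mathfrak{A}}$ (in 1 and 2, for all $c_1,\dots,c_n\in\mathcal{C}_{\mathfrak{A}}$); 3. $v(A\land B)=1$ iff $v(A)=1$ and $v(B)=1$; 4. $v(A\lor B)=1$ iff $v(A)=1$ or $v(B)=1$; 5. $v(\neg(A\land B))=1$ iff $v(\neg A)=1$ or $v(\neg B)=1$; 6. $v(\neg(A\lor B))=1$ iff $v(\neg A)=1$ and $v(\neg B)=1$; 7. $v(\neg\neg A)=1$ iff $v(A)=1$; 8. if $v(\circ A)=1$, then ($v(A)=1$ iff $v(\neg A)=0$); 9. $v(\circ A)=1$ iff $v(\bullet A)=0$; 10. $v(\forall xA)=1$ iff $v(A(\overline{a}/x))=1$ for every $a\in\mathcal{D}$; 11. $v(\exists xA)=1$ iff $v(A(\overline{a}/x))=1$ for some $a\in\mathcal{D}$; 12. $v(\neg\forall xA)=1$ iff $v(\neg A(\overline{a}/x))=1$ for some $a\in\mathcal{D}$; 13. $v(\neg\exists xA)=1$ iff $v(\neg A(\overline{a}/x))=1$ for every $a\in\mathcal{D}$; 14. if $A'$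 is an alphabetic variant of $A$, then $v(A')=v(A)$; 15. if $A\in Form(\mathcal{S}_{\mathfrak{A}})$ has no free variable other than $x$, $c_1,c_2\in\mathcal{C}_{\mathfrak{A}}$, $c_1^{\widehat{\mathfrak{A}}}=c_2^{\widehat{\mathfrak{A}}}$ and $v(A(c_1/x))=v(A(c_2/x))$, then $v(\#A(c_1/x))=v(\#A(c_2/x))$ for each $\#\in\{\neg,\circ,\bullet\}$. An $\mathcal{S}$-interpretation is a pair $\langle\mathfrak{A},v\rangle$ with $\mathfrak{A}$ an $\mathcal{S}$-structure and $v$ an $\mathfrak{A}$-valuation. $\mathfrak{A},v\vDash A$ means $v(A)=1$; $\mathfrak{A},v\vDash\Gamma$ means $v(B)=1$ for every $B\in\Gamma$. $\Gamma\vDash A$ means: for every $\mathcal{S}$-interpretation, $\mathfrak{A},v\vDash\Gamma$ implies $\mathfrak{A},v\vDash A$. *)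

theory Defs
  imports Main
begin

section \<open>Language\<close>

record ('c, 'p) signature =
  constants :: "'c set"
  predicates :: "'p set"
  arity :: "'p \<Rightarrow> nat"
  ident :: 'p

definition is_signature :: "('c, 'p) signature \<Rightarrow> bool" where
  "is_signature S \<longleftrightarrow>
     infinite (constants S) \<and> ident S \<in> predicates S \<and> arity S (ident S) = 2"

datatype (tm_consts: 'c) tm = Var nat | Cst 'c

text \<open>
  Raw formulas over arbitrary symbols; \<open>Form S\<close> below selects the actual formulas
  of a signature. The generated function \<open>fm_consts\<close> gives the constants
  occurring in a formula.
\<close>

datatype (fm_consts: 'c, fm_preds: 'p) fm =
    Atom 'p "'c tm list"
  | Neg "('c, 'p) fm"
  | Circ "('c, 'p) fm"
  | Bullet "('c, 'p) fm"
  | Conj "('c, 'p) fm" "('c, 'p) fm"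
  | Disj "('c, 'p) fm" "('c, 'p) fm"
  | All nat "('c, 'p) fm"
  | Ex nat "('c, 'p) fm"

primrec tm_vars :: "'c tm \<Rightarrow> nat set" where
  "tm_vars (Var x) = {x}"
| "tm_vars (Cst c) = {}"

primrec fv :: "('c, 'p) fm \<Rightarrow> nat set" where
  "fv (Atom P ts) = (\<Union>t\<in>set ts. tm_vars t)"
| "fv (Neg A) = fv A"
| "fv (Circ A) = fv A"
| "fv (Bullet A) = fv A"
| "fv (Conj A B) = fv A \<union> fv B"
| "fv (Disj A B) = fv A \<union> fv B"
| "fv (All x A) = fv A - {x}"
| "fv (Ex x A) = fv A - {x}"

text \<open>The conditions \<open>x \<in> fv A\<close> exclude void quantifiers.\<close>

primrec is_formula :: "('c, 'p) signature \<Rightarrow> ('c, 'p) fm \<Rightarrow> bool" where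
  "is_formula S (Atom P ts) \<longleftrightarrow>
     P \<in> predicates S \<and> length ts = arity S P \<and> (\<forall>t\<in>set ts. tm_consts t \<subseteq> constants S)"
| "is_formula S (Neg A) \<longleftrightarrow> is_formula S A"
| "is_formula S (Circ A) \<longleftrightarrow> is_formula S A"
| "is_formula S (Bullet A) \<longleftrightarrow> is_formula S A"
| "is_formula S (Conj A B) \<longleftrightarrow> is_formula S A \<and> is_formula S B"
| "is_formula S (Disj A B) \<longleftrightarrow> is_formula S A \<and> is_formula S B"
| "is_formula S (All x A) \<longleftrightarrow> is_formula S A \<and> x \<in> fv A"
| "is_formula S (Ex x A) \<longleftrightarrow> is_formula S A \<and> x \<in> fv A"

definition Form :: "('c, 'p) signature \<Rightarrow> ('c, 'p) fm set" where
  "Form S = {A. is_formula S A}"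

definition Sent :: "('c, 'p) signature \<Rightarrow> ('c, 'p) fm set" where
  "Sent S = {A \<in> Form S. fv A = {}}"

primrec tm_subst :: "'c tm \<Rightarrow> 'c tm \<Rightarrow> nat \<Rightarrow> 'c tm" where
  "tm_subst (Var y) t x = (if y = x then t else Var y)"
| "tm_subst (Cst c) t x = Cst c"

text \<open>
  \<open>fm_subst A t x\<close> is \<open>A(t/x)\<close>. Bound variables are not renamed; below, only
  constants are substituted, so no capture can occur.
\<close>

primrec fm_subst :: "('c, 'p) fm \<Rightarrow> 'c tm \<Rightarrow> nat \<Rightarrow> ('c, 'p) fm" where
  "fm_subst (Atom P ts) t x = Atom P (map (\<lambda>s. tm_subst s t x) ts)"
| "fm_subst (Neg A) t x = Neg (fm_subst A t x)"
| "fm_subst (Circ A) t x = Circ (fm_subst A t x)"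
| "fm_subst (Bullet A) t x = Bullet (fm_subst A t x)"
| "fm_subst (Conj A B) t x = Conj (fm_subst A t x) (fm_subst B t x)"
| "fm_subst (Disj A B) t x = Disj (fm_subst A t x) (fm_subst B t x)"
| "fm_subst (All y A) t x = All y (if y = x then A else fm_subst A t x)"
| "fm_subst (Ex y A) t x = Ex y (if y = x then A else fm_subst A t x)"

abbreviation inst :: "('c, 'p) fm \<Rightarrow> 'c \<Rightarrow> nat \<Rightarrow> ('c, 'p) fm" where
  "inst A c x \<equiv> fm_subst A (Cst c) x"

text \<open>
  Alphabetic variants are compared by a simultaneous descent. The list pairs the
  variables bound by corresponding quantifiers above the current position, innermost
  first. Two variable occurrences match iff they are bound by corresponding
  quantifiers, or both are free and equal.
\<close>

fun var_match :: "(nat \<times> nat) list \<Rightarrow> nat \<Rightarrow> nat \<Rightarrow> bool" where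
  "var_match [] x y \<longleftrightarrow> x = y"
| "var_match ((a, b) # bs) x y \<longleftrightarrow>
     (x = a \<and> y = b) \<or> (x \<noteq> a \<and> y \<noteq> b \<and> var_match bs x y)"

inductive tm_match :: "(nat \<times> nat) list \<Rightarrow> 'c tm \<Rightarrow> 'c tm \<Rightarrow> bool" where
  "var_match bs x y \<Longrightarrow> tm_match bs (Var x) (Var y)"
| "tm_match bs (Cst c) (Cst c)"

inductive fm_match :: "(nat \<times> nat) list \<Rightarrow> ('c, 'p) fm \<Rightarrow> ('c, 'p) fm \<Rightarrow> bool" where
  "list_all2 (tm_match bs) ts us \<Longrightarrow> fm_match bs (Atom P ts) (Atom P us)"
| "fm_match bs A A' \<Longrightarrow> fm_match bs (Neg A) (Neg A')"
| "fm_match bs A A' \<Longrightarrow> fm_match bs (Circ A) (Circ A')"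
| "fm_match bs A A' \<Longrightarrow> fm_match bs (Bullet A) (Bullet A')"
| "fm_match bs A A' \<Longrightarrow> fm_match bs B B' \<Longrightarrow> fm_match bs (Conj A B) (Conj A' B')"
| "fm_match bs A A' \<Longrightarrow> fm_match bs B B' \<Longrightarrow> fm_match bs (Disj A B) (Disj A' B')"
| "fm_match ((x, y) # bs) A A' \<Longrightarrow> fm_match bs (All x A) (All y A')"
| "fm_match ((x, y) # bs) A A' \<Longrightarrow> fm_match bs (Ex x A) (Ex y A')"

definition alphabetic_variant :: "('c, 'p) fm \<Rightarrow> ('c, 'p) fm \<Rightarrow> bool" where
  "alphabetic_variant A A' \<longleftrightarrow> fm_match [] A A'"


section \<open>Natural deduction\<close>

text \<open>
  \<open>derivation S H A\<close>: there is a derivation tree with conclusion \<open>A\<close> whose set of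
  undischarged hypotheses is exactly \<open>H\<close>. A discharging rule removes all occurrences
  of the hypothesis it discharges, of which there may be none; retaining some of them
  would only enlarge the set of open hypotheses. Membership in \<open>Sent S\<close> is
  required wherever it does not follow from the premises.
\<close>

inductive derivation ::
  "('c, 'p) signature \<Rightarrow> ('c, 'p) fm set \<Rightarrow> ('c, 'p) fm \<Rightarrow> bool"
  for S :: "('c, 'p) signature" where
  Hyp: "A \<in> Sent S \<Longrightarrow> derivation S {A} A"
| ConjI: "derivation S H1 A \<Longrightarrow> derivation S H2 B \<Longrightarrow> derivation S (H1 \<union> H2) (Conj A B)"
| ConjE1: "derivation S H (Conj A B) \<Longrightarrow> derivation S H A"
| ConjE2: "derivation S H (Conj A B) \<Longrightarrow> derivation S H B"
| DisjI1: "derivation S H A \<Longrightarrow> B \<in> Sent S \<Longrightarrow> derivation S H (Disj A B)"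
| DisjI2: "derivation S H B \<Longrightarrow> A \<in> Sent S \<Longrightarrow> derivation S H (Disj A B)"
| DisjE: "derivation S H (Disj A B) \<Longrightarrow> derivation S H1 C \<Longrightarrow> derivation S H2 C \<Longrightarrow>
    derivation S (H \<union> (H1 - {A}) \<union> (H2 - {B})) C"
| NegConjI1: "derivation S H (Neg A) \<Longrightarrow> B \<in> Sent S \<Longrightarrow> derivation S H (Neg (Conj A B))"
| NegConjI2: "derivation S H (Neg B) \<Longrightarrow> A \<in> Sent S \<Longrightarrow> derivation S H (Neg (Conj A B))"
| NegConjE: "derivation S H (Neg (Conj A B)) \<Longrightarrow> derivation S H1 C \<Longrightarrow> derivation S H2 C \<Longrightarrow>
    derivation S (H \<union> (H1 - {Neg A}) \<union> (H2 - {Neg B})) C"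
| NegDisjI: "derivation S H1 (Neg A) \<Longrightarrow> derivation S H2 (Neg B) \<Longrightarrow>
    derivation S (H1 \<union> H2) (Neg (Disj A B))"
| NegDisjE1: "derivation S H (Neg (Disj A B)) \<Longrightarrow> derivation S H (Neg A)"
| NegDisjE2: "derivation S H (Neg (Disj A B)) \<Longrightarrow> derivation S H (Neg B)"
| DNI: "derivation S H A \<Longrightarrow> derivation S H (Neg (Neg A))"
| DNE: "derivation S H (Neg (Neg A)) \<Longrightarrow> derivation S H A"
| EXP: "derivation S H1 (Circ A) \<Longrightarrow> derivation S H2 A \<Longrightarrow> derivation S H3 (Neg A) \<Longrightarrow>
    B \<in> Sent S \<Longrightarrow> derivation S (H1 \<union> H2 \<union> H3) B"
| PEM: "derivation S H (Circ A) \<Longrightarrow> derivation S H (Disj A (Neg A))"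
| Cons: "derivation S H1 (Circ A) \<Longrightarrow> derivation S H2 (Bullet A) \<Longrightarrow> B \<in> Sent S \<Longrightarrow>
    derivation S (H1 \<union> H2) B"
| Comp: "A \<in> Sent S \<Longrightarrow> derivation S {} (Disj (Circ A) (Bullet A))"
| AllI: "derivation S H (Disj B (inst A c x)) \<Longrightarrow> All x A \<in> Sent S \<Longrightarrow> c \<in> constants S \<Longrightarrow>
    c \<notin> fm_consts A \<Longrightarrow> c \<notin> fm_consts B \<Longrightarrow> (\<And>D. D \<in> H \<Longrightarrow> c \<notin> fm_consts D) \<Longrightarrow>
    derivation S H (Disj B (All x A))"
| AllE: "derivation S H (All x A) \<Longrightarrow> c \<in> constants S \<Longrightarrow> derivation S H (inst A c x)"
| ExI: "derivation S H (inst A c x) \<Longrightarrow> Ex x A \<in> Sent S \<Longrightarrow> c \<in> constants S \<Longrightarrow>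
    derivation S H (Ex x A)"
| ExE: "derivation S H (Ex x A) \<Longrightarrow> derivation S H1 C \<Longrightarrow> c \<in> constants S \<Longrightarrow>
    c \<notin> fm_consts A \<Longrightarrow> c \<notin> fm_consts C \<Longrightarrow>
    (\<And>D. D \<in> H1 - {inst A c x} \<Longrightarrow> c \<notin> fm_consts D) \<Longrightarrow>
    derivation S (H \<union> (H1 - {inst A c x})) C"
| NegAllI: "derivation S H (Neg (inst A c x)) \<Longrightarrow> All x A \<in> Sent S \<Longrightarrow> c \<in> constants S \<Longrightarrow>
    derivation S H (Neg (All x A))"
| NegAllE: "derivation S H (Neg (All x A)) \<Longrightarrow> derivation S H1 C \<Longrightarrow> c \<in> constants S \<Longrightarrow>
    c \<notin> fm_consts A \<Longrightarrow> c \<notin> fm_consts C \<Longrightarrow>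
    (\<And>D. D \<in> H1 - {Neg (inst A c x)} \<Longrightarrow> c \<notin> fm_consts D) \<Longrightarrow>
    derivation S (H \<union> (H1 - {Neg (inst A c x)})) C"
| NegExI: "derivation S H (Neg (inst A c x)) \<Longrightarrow> Ex x A \<in> Sent S \<Longrightarrow> c \<in> constants S \<Longrightarrow>
    c \<notin> fm_consts A \<Longrightarrow> (\<And>D. D \<in> H \<Longrightarrow> c \<notin> fm_consts D) \<Longrightarrow>
    derivation S H (Neg (Ex x A))"
| NegExE: "derivation S H (Neg (Ex x A)) \<Longrightarrow> c \<in> constants S \<Longrightarrow>
    derivation S H (Neg (inst A c x))"
| IdI: "c \<in> constants S \<Longrightarrow> derivation S {} (Atom (ident S) [Cst c, Cst c])"
| IdE: "derivation S H1 (Atom (ident S) [Cst c1, Cst c2]) \<Longrightarrow>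
    derivation S H2 (inst A c1 x) \<Longrightarrow> A \<in> Form S \<Longrightarrow> fv A \<subseteq> {x} \<Longrightarrow>
    c1 \<in> constants S \<Longrightarrow> c2 \<in> constants S \<Longrightarrow>
    derivation S (H1 \<union> H2) (inst A c2 x)"
| AV: "derivation S H A \<Longrightarrow> alphabetic_variant A A' \<Longrightarrow> A' \<in> Sent S \<Longrightarrow> derivation S H A'"

definition provable ::
  "('c, 'p) signature \<Rightarrow> ('c, 'p) fm set \<Rightarrow> ('c, 'p) fm \<Rightarrow> bool" where
  "provable S \<Gamma> A \<longleftrightarrow> (\<exists>H \<subseteq> \<Gamma>. derivation S H A)"


section \<open>Semantics\<close>

record ('c, 'p, 'd) interp =
  dom :: "'d set"
  const_val :: "'c \<Rightarrow> 'd"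
  pos_ext :: "'p \<Rightarrow> 'd list set"
  neg_ext :: "'p \<Rightarrow> 'd list set"

definition is_structure :: "('c, 'p) signature \<Rightarrow> ('c, 'p, 'd) interp \<Rightarrow> bool" where
  "is_structure S \<AA> \<longleftrightarrow>
     dom \<AA> \<noteq> {} \<and>
     (\<forall>c\<in>constants S. const_val \<AA> c \<in> dom \<AA>) \<and>
     (\<forall>P\<in>predicates S.
        pos_ext \<AA> P \<union> neg_ext \<AA> P \<subseteq> {ds. length ds = arity S P \<and> set ds \<subseteq> dom \<AA>}) \<and>
     pos_ext \<AA> (ident S) = {[a, a] | a. a \<in> dom \<AA>}"

text \<open>
  The diagram language uses the disjoint sum \<open>'c + 'd\<close> of constants: \<open>Inl c\<close> is the
  original constant \<open>c\<close> and \<open>Inr a\<close> is the new name of the element \<open>a\<close>. A formula of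
  the original language is carried over by \<open>map_fm Inl id\<close>.
\<close>

definition diagram_signature ::
  "('c, 'p) signature \<Rightarrow> ('c, 'p, 'd) interp \<Rightarrow> ('c + 'd, 'p) signature" where
  "diagram_signature S \<AA> =
     \<lparr>constants = Inl ` constants S \<union> Inr ` dom \<AA>,
      predicates = predicates S, arity = arity S, ident = ident S\<rparr>"

definition diagram_structure :: "('c, 'p, 'd) interp \<Rightarrow> ('c + 'd, 'p, 'd) interp" where
  "diagram_structure \<AA> =
     \<lparr>dom = dom \<AA>, const_val = case_sum (const_val \<AA>) id,
      pos_ext = pos_ext \<AA>, neg_ext = neg_ext \<AA>\<rparr>"

text \<open>
  Truth values 1 and 0 are \<open>True\<close> and \<open>False\<close>. A valuation is a total function on raw
  formulas, but only its values on sentences of the diagram language are constrained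
  or used.
\<close>

definition is_valuation ::
  "('c, 'p) signature \<Rightarrow> ('c, 'p, 'd) interp \<Rightarrow> (('c + 'd, 'p) fm \<Rightarrow> bool) \<Rightarrow> bool" where
  "is_valuation S \<AA> v \<longleftrightarrow>
    (let S' = diagram_signature S \<AA>; val = const_val (diagram_structure \<AA>) in
     (\<forall>P\<in>predicates S. \<forall>cs. length cs = arity S P \<and> set cs \<subseteq> constants S' \<longrightarrow>
        (v (Atom P (map Cst cs)) \<longleftrightarrow> map val cs \<in> pos_ext \<AA> P)) \<and>
     (\<forall>P\<in>predicates S. \<forall>cs. length cs = arity S P \<and> set cs \<subseteq> constants S' \<longrightarrow>
        (v (Neg (Atom P (map Cst cs))) \<longleftrightarrow> map val cs \<in> neg_ext \<AA> P)) \<and>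
     (\<forall>A\<in>Sent S'. \<forall>B\<in>Sent S'. v (Conj A B) \<longleftrightarrow> v A \<and> v B) \<and>
     (\<forall>A\<in>Sent S'. \<forall>B\<in>Sent S'. v (Disj A B) \<longleftrightarrow> v A \<or> v B) \<and>
     (\<forall>A\<in>Sent S'. \<forall>B\<in>Sent S'. v (Neg (Conj A B)) \<longleftrightarrow> v (Neg A) \<or> v (Neg B)) \<and>
     (\<forall>A\<in>Sent S'. \<forall>B\<in>Sent S'. v (Neg (Disj A B)) \<longleftrightarrow> v (Neg A) \<and> v (Neg B)) \<and>
     (\<forall>A\<in>Sent S'. v (Neg (Neg A)) \<longleftrightarrow> v A) \<and>
     (\<forall>A\<in>Sent S'. v (Circ A) \<longrightarrow> (v A \<longleftrightarrow> \<not> v (Neg A))) \<and>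
     (\<forall>A\<in>Sent S'. v (Circ A) \<longleftrightarrow> \<not> v (Bullet A)) \<and>
     (\<forall>x A. All x A \<in> Sent S' \<longrightarrow>
        (v (All x A) \<longleftrightarrow> (\<forall>a\<in>dom \<AA>. v (inst A (Inr a) x)))) \<and>
     (\<forall>x A. Ex x A \<in> Sent S' \<longrightarrow>
        (v (Ex x A) \<longleftrightarrow> (\<exists>a\<in>dom \<AA>. v (inst A (Inr a) x)))) \<and>
     (\<forall>x A. All x A \<in> Sent S' \<longrightarrow>
        (v (Neg (All x A)) \<longleftrightarrow> (\<exists>a\<in>dom \<AA>. v (Neg (inst A (Inr a) x))))) \<and>
     (\<forall>x A. Ex x A \<in> Sent S' \<longrightarrow>
        (v (Neg (Ex x A)) \<longleftrightarrow> (\<forall>a\<in>dom \<AA>. v (Neg (inst A (Inr a) x))))) \<and>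
     (\<forall>A\<in>Sent S'. \<forall>A'\<in>Sent S'. alphabetic_variant A A' \<longrightarrow> v A' = v A) \<and>
     (\<forall>A\<in>Form S'. \<forall>x. \<forall>c1\<in>constants S'. \<forall>c2\<in>constants S'.
        fv A \<subseteq> {x} \<and> val c1 = val c2 \<and> v (inst A c1 x) = v (inst A c2 x) \<longrightarrow>
        v (Neg (inst A c1 x)) = v (Neg (inst A c2 x)) \<and>
        v (Circ (inst A c1 x)) = v (Circ (inst A c2 x)) \<and>
        v (Bullet (inst A c1 x)) = v (Bullet (inst A c2 x))))"

definition is_interpretation ::
  "('c, 'p) signature \<Rightarrow> ('c, 'p, 'd) interp \<Rightarrow> (('c + 'd, 'p) fm \<Rightarrow> bool) \<Rightarrow> bool" where
  "is_interpretation S \<AA> v \<longleftrightarrow> is_structure S \<AA> \<and> is_valuation S \<AA> v"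

definition satisfies :: "(('c + 'd, 'p) fm \<Rightarrow> bool) \<Rightarrow> ('c, 'p) fm \<Rightarrow> bool" where
  "satisfies v A \<longleftrightarrow> v (map_fm Inl id A)"

text \<open>
  HOL cannot quantify over types inside a formula, so consequence is indexed by the
  type \<open>'d\<close> from which domains (arbitrary nonempty subsets) are drawn. Leaving
  \<open>'d\<close> a free type variable in a theorem makes it hold for all domains.
\<close>

definition entails ::
  "'d itself \<Rightarrow> ('c, 'p) signature \<Rightarrow> ('c, 'p) fm set \<Rightarrow> ('c, 'p) fm \<Rightarrow> bool" where
  "entails _ S \<Gamma> A \<longleftrightarrow>
     (\<forall>(\<AA> :: ('c, 'p, 'd) interp) v.
        is_interpretation S \<AA> v \<longrightarrow> (\<forall>B\<in>\<Gamma>. satisfies v B) \<longrightarrow> satisfies v A)"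

end

theory Submission
  imports Defs
begin

text \<open>
  Valuations are not compositional in \<open>\<not>\<close>, \<open>\<circ>\<close> and \<open>\<bullet>\<close>, so the eigenvariable rules cannot be
  handled by a semantic substitution lemma. Instead the claim is strengthened: for a fixed
  valuation \<open>v\<close>, derivations preserve truth under every replacement \<open>f\<close> of the constants of
  \<open>S\<close> by constants of the diagram language. Soundness is the case \<open>f = Inl\<close>, and at a rule
  with eigenvariable \<open>c\<close> the induction hypothesis is applied to \<open>f(c := Inr a)\<close>. The clause on
  codenoting constants yields, by induction on formulas, that codenoting constants are
  interchangeable, which covers the remaining quantifier rules and \<open>\<approx>E\<close>.
\<close>

section \<open>Instantiation and replacement of constants\<close>

lemma tm_vars_tm_subst_Cst: "tm_vars (tm_subst t (Cst c) x) = tm_vars t - {x}"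
  by (cases t) auto

lemma tm_vars_map_tm [simp]: "tm_vars (map_tm f t) = tm_vars t"
  by (cases t) auto

lemma fv_inst [simp]: "fv (inst A c x) = fv A - {x}"
  by (induction A) (auto simp: tm_vars_tm_subst_Cst)

text \<open>The target type may differ from the source, so one operation covers both the embedding
  into the diagram language (\<open>f = Inl\<close>) and the reassignment of single
  constants.\<close>

definition map_consts :: "('c \<Rightarrow> 'd) \<Rightarrow> ('c, 'p) fm \<Rightarrow> ('d, 'p) fm" where
  "map_consts f = map_fm f id"

lemma map_consts_simps [simp]:
  "map_consts f (Atom P ts) = Atom P (map (map_tm f) ts)"
  "map_consts f (Neg A) = Neg (map_consts f A)"
  "map_consts f (Circ A) = Circ (map_consts f A)"
  "map_consts f (Bullet A) = Bullet (map_consts f A)"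
  "map_consts f (Conj A B) = Conj (map_consts f A) (map_consts f B)"
  "map_consts f (Disj A B) = Disj (map_consts f A) (map_consts f B)"
  "map_consts f (All x A) = All x (map_consts f A)"
  "map_consts f (Ex x A) = Ex x (map_consts f A)"
  by (simp_all add: map_consts_def)

lemma fv_map_consts [simp]: "fv (map_consts f A) = fv A"
  by (induction A) auto

lemma tm_consts_tm_subst: "tm_consts (tm_subst t (Cst c) x) \<subseteq> insert c (tm_consts t)"
  by (cases t) auto

lemma is_formula_inst:
  "is_formula S A \<Longrightarrow> c \<in> constants S \<Longrightarrow> is_formula S (inst A c x)"
  using tm_consts_tm_subst by (induction A) fastforce+

lemma tm_subst_Cst_commute:
  "x \<noteq> y \<Longrightarrow> tm_subst (tm_subst t (Cst c) x) (Cst d) y = tm_subst (tm_subst t (Cst d) y) (Cst c) x"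
  by (cases t) auto

text \<open>Constants are closed terms, so neither substitution creates or destroys occurrences of
  the other variable.\<close>

lemma inst_commute: "x \<noteq> y \<Longrightarrow> inst (inst A c x) d y = inst (inst A d y) c x"
  by (induction A) (auto simp: tm_subst_Cst_commute)

lemma map_tm_tm_subst: "map_tm f (tm_subst t (Cst c) x) = tm_subst (map_tm f t) (Cst (f c)) x"
  by (cases t) auto

text \<open>The substituted constant is itself replaced. Sending \<open>c\<close> to
  \<open>Inr a\<close> thus turns a \<open>c\<close>-instance into the \<open>a\<close>-instance of
  which the valuation clauses speak.\<close>

lemma map_consts_inst: "map_consts f (inst A c x) = inst (map_consts f A) (f c) x"
  by (induction A) (auto simp: map_tm_tm_subst)

text \<open>This is how the eigenvariable conditions enter: formulas without \<open>c\<close> do not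
  notice a change of \<open>f\<close> at \<open>c\<close>.\<close>

lemma map_consts_fun_upd: "c \<notin> fm_consts A \<Longrightarrow> map_consts (f(c := d)) A = map_consts f A"
  unfolding map_consts_def by (rule fm.map_cong0) auto

text \<open>Matching compares binding structure, which \<open>f\<close> leaves alone, and equal
  constants stay equal under any \<open>f\<close>.\<close>

lemma fm_match_map_consts: "fm_match bs A A' \<Longrightarrow> fm_match bs (map_consts f A) (map_consts f A')"
proof (induction rule: fm_match.induct)
  case (1 bs ts us P)
  then have "list_all2 (tm_match bs) (map (map_tm f) ts) (map (map_tm f) us)"
    unfolding list_all2_map1 list_all2_map2
    by (rule list_all2_mono) (auto elim!: tm_match.cases intro: tm_match.intros)
  then show ?case
    by (simp add: fm_match.intros)
qed (auto intro: fm_match.intros)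

section \<open>Sentences and their instances\<close>

lemma SentI: "is_formula S A \<Longrightarrow> fv A = {} \<Longrightarrow> A \<in> Sent S"
  by (simp add: Sent_def Form_def)

lemma Sent_simps [simp]:
  "Neg A \<in> Sent S \<longleftrightarrow> A \<in> Sent S"
  "Circ A \<in> Sent S \<longleftrightarrow> A \<in> Sent S"
  "Bullet A \<in> Sent S \<longleftrightarrow> A \<in> Sent S"
  "Conj A B \<in> Sent S \<longleftrightarrow> A \<in> Sent S \<and> B \<in> Sent S"
  "Disj A B \<in> Sent S \<longleftrightarrow> A \<in> Sent S \<and> B \<in> Sent S"
  by (auto simp: Sent_def Form_def)

lemma Sent_inst:
  "is_formula S A \<Longrightarrow> fv A \<subseteq> {x} \<Longrightarrow> c \<in> constants S \<Longrightarrow> inst A c x \<in> Sent S"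
  by (intro SentI is_formula_inst) auto

lemma Sent_AllD: "All x A \<in> Sent S \<Longrightarrow> is_formula S A \<and> fv A \<subseteq> {x}"
  by (auto simp: Sent_def Form_def)

lemma Sent_ExD: "Ex x A \<in> Sent S \<Longrightarrow> is_formula S A \<and> fv A \<subseteq> {x}"
  by (auto simp: Sent_def Form_def)

text \<open>The valuation clauses constrain \<open>v\<close> on sentences only, so each of their
  uses on a premise needs this fact. The signature hypothesis serves the case \<open>IdI\<close>,
  where identity must be a binary predicate of \<open>S\<close>.\<close>

lemma derivation_Sent:
  assumes "is_signature S" and "derivation S H A"
  shows "A \<in> Sent S"
  using assms(2)
proof (induction rule: derivation.induct)
  case (IdI c)
  then show ?case
    using assms(1) by (auto simp: is_signature_def Sent_def Form_def)
next
  case (IdE H1 c1 c2 H2 A x)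
  then show ?case by (auto simp: Form_def intro: Sent_inst)
qed (auto dest: Sent_AllD Sent_ExD intro: Sent_inst)

text \<open>An instance of a quantifier's body is not a subformula, but it is smaller than the
  quantified formula; this licenses induction on size.\<close>

lemma size_inst [simp]: "size (inst A c x) = size A"
proof (induction A)
  case (Atom P ts)
  have "size (tm_subst t (Cst c) x) = size t" for t :: "'a tm"
    by (cases t) auto
  then show ?case
    by (simp add: comp_def)
qed auto

section \<open>Truth in a fixed interpretation\<close>

text \<open>The structure does not determine the valuation, so \<open>v\<close> is fixed together
  with it; only the replacement of constants varies later.\<close>

locale valued_structure =
  fixes S :: "('c, 'p) signature"
    and \<AA> :: "('c, 'p, 'd) interp"
    and v :: "('c + 'd, 'p) fm \<Rightarrow> bool"
  assumes sig: "is_signature S"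
    and interp: "is_interpretation S \<AA> v"
begin

abbreviation S' :: "('c + 'd, 'p) signature" where
  "S' \<equiv> diagram_signature S \<AA>"

abbreviation val :: "'c + 'd \<Rightarrow> 'd" where
  "val \<equiv> const_val (diagram_structure \<AA>)"

section \<open>Denotations and the individual valuation clauses\<close>

lemma val_Inr [simp]: "val (Inr a) = a"
  by (simp add: diagram_structure_def)

lemma val_in_dom: "c \<in> constants S' \<Longrightarrow> val c \<in> dom \<AA>"
  using interp
  by (auto simp: diagram_structure_def diagram_signature_def is_interpretation_def is_structure_def)

lemma Inr_in_constants [simp]: "a \<in> dom \<AA> \<Longrightarrow> Inr a \<in> constants S'"
  by (simp add: diagram_signature_def)

lemma pos_ext_ident: "pos_ext \<AA> (ident S) = {[a, a] | a. a \<in> dom \<AA>}"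
  using interp by (simp add: is_interpretation_def is_structure_def)

lemma valuation: "is_valuation S \<AA> v"
  using interp by (simp add: is_interpretation_def)

lemmas v_clauses = valuation[unfolded is_valuation_def Let_def]

lemma v_Atom:
  "P \<in> predicates S \<Longrightarrow> length cs = arity S P \<Longrightarrow> set cs \<subseteq> constants S' \<Longrightarrow>
    v (Atom P (map Cst cs)) \<longleftrightarrow> map val cs \<in> pos_ext \<AA> P"
  using v_clauses[THEN conjunct1] by blast

lemmas connective_clauses = v_clauses[THEN conjunct2, THEN conjunct2]

lemma v_Conj: "A \<in> Sent S' \<Longrightarrow> B \<in> Sent S' \<Longrightarrow> v (Conj A B) \<longleftrightarrow> v A \<and> v B"
  using connective_clauses[THEN conjunct1] by blast

lemma v_Disj: "A \<in> Sent S' \<Longrightarrow> B \<in> Sent S' \<Longrightarrow> v (Disj A B) \<longleftrightarrow> v A \<or> v B"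
  using connective_clauses[THEN conjunct2, THEN conjunct1] by blast

lemma v_Neg_Conj: "A \<in> Sent S' \<Longrightarrow> B \<in> Sent S' \<Longrightarrow> v (Neg (Conj A B)) \<longleftrightarrow> v (Neg A) \<or> v (Neg B)"
  using connective_clauses[THEN conjunct2, THEN conjunct2, THEN conjunct1] by blast

lemma v_Neg_Disj: "A \<in> Sent S' \<Longrightarrow> B \<in> Sent S' \<Longrightarrow> v (Neg (Disj A B)) \<longleftrightarrow> v (Neg A) \<and> v (Neg B)"
  using connective_clauses[THEN conjunct2, THEN conjunct2, THEN conjunct2, THEN conjunct1] by blast

lemma v_Neg_Neg: "A \<in> Sent S' \<Longrightarrow> v (Neg (Neg A)) \<longleftrightarrow> v A"
  using connective_clauses[THEN conjunct2, THEN conjunct2, THEN conjunct2, THEN conjunct2, THEN conjunct1] by blast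

lemma v_CircD: "A \<in> Sent S' \<Longrightarrow> v (Circ A) \<Longrightarrow> v A \<longleftrightarrow> \<not> v (Neg A)"
  using connective_clauses[THEN conjunct2, THEN conjunct2, THEN conjunct2,
      THEN conjunct2, THEN conjunct2, THEN conjunct1] by blast

lemma v_Circ: "A \<in> Sent S' \<Longrightarrow> v (Circ A) \<longleftrightarrow> \<not> v (Bullet A)"
  using connective_clauses[THEN conjunct2, THEN conjunct2, THEN conjunct2,
      THEN conjunct2, THEN conjunct2, THEN conjunct2, THEN conjunct1] by blast

lemmas quantifier_clauses = connective_clauses[THEN conjunct2, THEN conjunct2,
    THEN conjunct2, THEN conjunct2, THEN conjunct2, THEN conjunct2, THEN conjunct2]

lemma v_All: "All x A \<in> Sent S' \<Longrightarrow> v (All x A) \<longleftrightarrow> (\<forall>a\<in>dom \<AA>. v (inst A (Inr a) x))"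
  using quantifier_clauses[THEN conjunct1] by blast

lemma v_Ex: "Ex x A \<in> Sent S' \<Longrightarrow> v (Ex x A) \<longleftrightarrow> (\<exists>a\<in>dom \<AA>. v (inst A (Inr a) x))"
  using quantifier_clauses[THEN conjunct2, THEN conjunct1] by blast

lemma v_Neg_All:
  "All x A \<in> Sent S' \<Longrightarrow> v (Neg (All x A)) \<longleftrightarrow> (\<exists>a\<in>dom \<AA>. v (Neg (inst A (Inr a) x)))"
  using quantifier_clauses[THEN conjunct2, THEN conjunct2, THEN conjunct1] by blast

lemma v_Neg_Ex:
  "Ex x A \<in> Sent S' \<Longrightarrow> v (Neg (Ex x A)) \<longleftrightarrow> (\<forall>a\<in>dom \<AA>. v (Neg (inst A (Inr a) x)))"
  using quantifier_clauses[THEN conjunct2, THEN conjunct2, THEN conjunct2, THEN conjunct1] by blast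

lemma v_alphabetic_variant:
  "A \<in> Sent S' \<Longrightarrow> A' \<in> Sent S' \<Longrightarrow> alphabetic_variant A A' \<Longrightarrow> v A' = v A"
  using v_clauses by blast

section \<open>Interchangeability of codenoting constants\<close>

lemma v_codenoting_unary:
  assumes "is_formula S' A" "fv A \<subseteq> {x}" "c1 \<in> constants S'" "c2 \<in> constants S'"
    and "val c1 = val c2" "v (inst A c1 x) = v (inst A c2 x)"
  shows "v (Neg (inst A c1 x)) = v (Neg (inst A c2 x)) \<and>
    v (Circ (inst A c1 x)) = v (Circ (inst A c2 x)) \<and>
    v (Bullet (inst A c1 x)) = v (Bullet (inst A c2 x))"
proof -
  have "A \<in> Form S'" using assms(1) by (simp add: Form_def)
  then show ?thesis using v_clauses assms(2-) by blast
qed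

text \<open>Induction on size: atoms see only denotations, binary connectives and quantifiers reduce
  to smaller sentences, and each unary operator is covered by the clause on codenoting constants,
  whose premise is the induction hypothesis.\<close>

lemma v_codenoting:
  assumes "is_formula S' A" "fv A \<subseteq> {x}" "c1 \<in> constants S'" "c2 \<in> constants S'"
    and "val c1 = val c2"
  shows "v (inst A c1 x) = v (inst A c2 x)"
  using assms(1,2)
proof (induction "size A" arbitrary: A rule: less_induct)
  case less
  note IH = less.hyps and sent = Sent_inst[of S'] and cs = assms(3-5)
  \<comment> \<open>The induction hypothesis is used for \<open>inst B (Inr a) y\<close>, in which
    at most \<open>x\<close> is free; commuting the two substitutions gives the form that the
    quantifier clauses produce.\<close>
  have quantified:
    "v (inst (inst B c1 x) (Inr a) y) = v (inst (inst B c2 x) (Inr a) y)"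
    if "size B < size A" "is_formula S' B" "fv B - {y} \<subseteq> {x}" "y \<noteq> x" "a \<in> dom \<AA>" for B y a
  proof -
    have "v (inst (inst B (Inr a) y) c1 x) = v (inst (inst B (Inr a) y) c2 x)"
      using that by (intro IH) (auto intro: is_formula_inst)
    then show ?thesis using that(4) by (simp add: inst_commute[of x y])
  qed
  show ?case
  proof (cases A)
    case (Atom P ts)
    have P: "P \<in> predicates S" "length ts = arity S P"
      using less.prems Atom by (auto simp: diagram_signature_def)
    have tms: "tm_vars t \<subseteq> {x}" "tm_consts t \<subseteq> constants S'" if "t \<in> set ts" for t
      using less.prems that Atom by auto
    \<comment> \<open>Any variable among \<open>ts\<close> must be \<open>x\<close>, so this is the
      list of constants to which the instance applies \<open>P\<close>.\<close>
    let ?cs = "\<lambda>c. map (\<lambda>t. case t of Var _ \<Rightarrow> c | Cst d \<Rightarrow> d) ts"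
    have inst: "inst A c x = Atom P (map Cst (?cs c))" for c
      using tms Atom by (fastforce split: tm.split)
    have "set (?cs c) \<subseteq> constants S'" if "c \<in> constants S'" for c
      using tms that by (fastforce split: tm.splits)
    moreover have "map val (?cs c1) = map val (?cs c2)"
      using cs by (auto split: tm.split)
    ultimately show ?thesis
      using P cs unfolding inst by (simp only: v_Atom length_map)
  next
    case (Neg B)
    \<comment> \<open>Truth of \<open>B\<close> does not fix truth of \<open>Neg B\<close>;
      agreement on the instances of \<open>B\<close> is lifted by the clause on codenoting
      constants.\<close>
    then show ?thesis
      using v_codenoting_unary[of B x c1 c2] IH[of B] less.prems cs by simp
  next
    case (Circ B)
    then show ?thesis
      using v_codenoting_unary[of B x c1 c2] IH[of B] less.prems cs by simp
  next
    case (Bullet B)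
    then show ?thesis
      using v_codenoting_unary[of B x c1 c2] IH[of B] less.prems cs by simp
  next
    case (Conj B C)
    then show ?thesis
      using IH[of B] IH[of C] less.prems cs by (simp add: v_Conj sent)
  next
    case (Disj B C)
    then show ?thesis
      using IH[of B] IH[of C] less.prems cs by (simp add: v_Disj sent)
  next
    case (All y B)
    show ?thesis
    \<comment> \<open>If \<open>y = x\<close>, the quantifier blocks the substitution and both
      instances coincide.\<close>
    proof (cases "y = x")
      case False
      \<comment> \<open>As \<open>y\<close> differs from \<open>x\<close>, it stays free in
        \<open>inst B c x\<close>, so the quantifier does not become void.\<close>
      have "All y (inst B c x) \<in> Sent S'" if "c \<in> constants S'" for c
        using that False less.prems All by (auto intro!: SentI is_formula_inst)
      then show ?thesis
        using False All less.prems cs quantified[of B y] by (simp add: v_All)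
    qed (simp add: All)
  next
    case (Ex y B)
    show ?thesis
    proof (cases "y = x")
      case False
      have "Ex y (inst B c x) \<in> Sent S'" if "c \<in> constants S'" for c
        using that False less.prems Ex by (auto intro!: SentI is_formula_inst)
      then show ?thesis
        using False Ex less.prems cs quantified[of B y] by (simp add: v_Ex)
    qed (simp add: Ex)
  qed
qed

text \<open>The quantifier clauses mention only names \<open>Inr a\<close>, whereas the rules
  instantiate by arbitrary constants. A constant codenotes with the name of its denotation; the
  negated form is \<open>v_codenoting\<close> for \<open>Neg A\<close>.\<close>

lemma v_inst_val:
  assumes "is_formula S' A" "fv A \<subseteq> {x}" "c \<in> constants S'"
  shows "v (inst A c x) = v (inst A (Inr (val c)) x)"
    and "v (Neg (inst A c x)) = v (Neg (inst A (Inr (val c)) x))"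
proof -
  show "v (inst A c x) = v (inst A (Inr (val c)) x)"
    using assms by (intro v_codenoting) (auto intro!: Inr_in_constants val_in_dom)
  have "v (inst (Neg A) c x) = v (inst (Neg A) (Inr (val c)) x)"
    using assms by (intro v_codenoting) (auto intro!: Inr_in_constants val_in_dom)
  then show "v (Neg (inst A c x)) = v (Neg (inst A (Inr (val c)) x))"
    by simp
qed

section \<open>Truth preservation along derivations\<close>

lemma is_formula_map_consts:
  assumes "f ` constants S \<subseteq> constants S'" "is_formula S A"
  shows "is_formula S' (map_consts f A)"
  using assms(2)
proof (induction A)
  case (Atom P ts)
  then have "tm_consts (map_tm f t) \<subseteq> constants S'" if "t \<in> set ts" for t
    using assms(1) that by (auto simp: tm.set_map)
  then show ?case
    using Atom by (simp add: diagram_signature_def)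
qed (auto simp: diagram_signature_def)

lemma Sent_map_consts:
  "f ` constants S \<subseteq> constants S' \<Longrightarrow> A \<in> Sent S \<Longrightarrow> map_consts f A \<in> Sent S'"
  using is_formula_map_consts[of f A] by (simp add: Sent_def Form_def)

lemma v_ident:
  assumes "c1 \<in> constants S'" "c2 \<in> constants S'"
  shows "v (Atom (ident S) [Cst c1, Cst c2]) \<longleftrightarrow> val c1 = val c2"
  using v_Atom[of "ident S" "[c1, c2]"] sig assms val_in_dom
  by (auto simp: is_signature_def pos_ext_ident)

text \<open>The map \<open>f\<close> is arbitrary in the induction, so that premises may be
  evaluated under an altered map. The image condition keeps all replaced sentences in the diagram
  language.\<close>

lemma derivation_sound:
  assumes "derivation S H A" "f ` constants S \<subseteq> constants S'"
    and "\<And>B. B \<in> H \<Longrightarrow> v (map_consts f B)"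
  shows "v (map_consts f A)"
  using assms
proof (induction arbitrary: f rule: derivation.induct)
  case (Hyp A)
  then show ?case by simp
next
  case (ConjI H1 A H2 B)
  have "v (map_consts f A)" by (rule ConjI.IH(1)) (use ConjI.prems in auto)
  moreover have "v (map_consts f B)" by (rule ConjI.IH(2)) (use ConjI.prems in auto)
  moreover have "map_consts f A \<in> Sent S'" "map_consts f B \<in> Sent S'"
    using ConjI.hyps ConjI.prems(1) by (auto intro: Sent_map_consts derivation_Sent[OF sig])
  ultimately show ?case by (simp add: v_Conj)
next
  case (ConjE1 H A B)
  have "v (map_consts f (Conj A B))" by (rule ConjE1.IH) (use ConjE1.prems in auto)
  moreover have "map_consts f (Conj A B) \<in> Sent S'"
    using ConjE1.hyps ConjE1.prems(1) by (intro Sent_map_consts derivation_Sent[OF sig])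
  ultimately show ?case by (simp add: v_Conj)
next
  case (ConjE2 H A B)
  have "v (map_consts f (Conj A B))" by (rule ConjE2.IH) (use ConjE2.prems in auto)
  moreover have "map_consts f (Conj A B) \<in> Sent S'"
    using ConjE2.hyps ConjE2.prems(1) by (intro Sent_map_consts derivation_Sent[OF sig])
  ultimately show ?case by (simp add: v_Conj)
next
  case (DisjI1 H A B)
  have "v (map_consts f A)" by (rule DisjI1.IH) (use DisjI1.prems in auto)
  moreover have "map_consts f A \<in> Sent S'" "map_consts f B \<in> Sent S'"
    using DisjI1.hyps DisjI1.prems(1) by (auto intro: Sent_map_consts derivation_Sent[OF sig])
  ultimately show ?case by (simp add: v_Disj)
next
  case (DisjI2 H B A)
  have "v (map_consts f B)" by (rule DisjI2.IH) (use DisjI2.prems in auto)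
  moreover have "map_consts f A \<in> Sent S'" "map_consts f B \<in> Sent S'"
    using DisjI2.hyps DisjI2.prems(1) by (auto intro: Sent_map_consts derivation_Sent[OF sig])
  ultimately show ?case by (simp add: v_Disj)
next
  case (DisjE H A B H1 C H2)
  have "v (map_consts f (Disj A B))" by (rule DisjE.IH(1)) (use DisjE.prems in auto)
  moreover have "map_consts f (Disj A B) \<in> Sent S'"
    using DisjE.hyps(1) DisjE.prems(1) by (intro Sent_map_consts derivation_Sent[OF sig])
  ultimately have "v (map_consts f A) \<or> v (map_consts f B)" by (simp add: v_Disj)
  then show ?case
  proof
    assume "v (map_consts f A)"
    \<comment> \<open>Each hypothesis in \<open>H1\<close> is either the true disjunct
      \<open>A\<close> or remains open.\<close>
    then show ?case by (intro DisjE.IH(2)) (use DisjE.prems in blast)+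
  next
    assume "v (map_consts f B)"
    then show ?case by (intro DisjE.IH(3)) (use DisjE.prems in blast)+
  qed
next
  case (NegConjI1 H A B)
  have "v (map_consts f (Neg A))" by (rule NegConjI1.IH) (use NegConjI1.prems in auto)
  moreover have "map_consts f (Neg A) \<in> Sent S'" "map_consts f B \<in> Sent S'"
    using NegConjI1.hyps NegConjI1.prems(1)
    by (blast intro: Sent_map_consts derivation_Sent[OF sig])+
  ultimately show ?case by (simp add: v_Neg_Conj)
next
  case (NegConjI2 H B A)
  have "v (map_consts f (Neg B))" by (rule NegConjI2.IH) (use NegConjI2.prems in auto)
  moreover have "map_consts f A \<in> Sent S'" "map_consts f (Neg B) \<in> Sent S'"
    using NegConjI2.hyps NegConjI2.prems(1)
    by (blast intro: Sent_map_consts derivation_Sent[OF sig])+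
  ultimately show ?case by (simp add: v_Neg_Conj)
next
  case (NegConjE H A B H1 C H2)
  have "v (map_consts f (Neg (Conj A B)))"
    by (rule NegConjE.IH(1)) (use NegConjE.prems in auto)
  moreover have "map_consts f (Neg (Conj A B)) \<in> Sent S'"
    using NegConjE.hyps(1) NegConjE.prems(1) by (intro Sent_map_consts derivation_Sent[OF sig])
  ultimately have "v (map_consts f (Neg A)) \<or> v (map_consts f (Neg B))"
    by (simp add: v_Neg_Conj)
  then show ?case
  proof
    assume "v (map_consts f (Neg A))"
    then show ?case by (intro NegConjE.IH(2)) (use NegConjE.prems in blast)+
  next
    assume "v (map_consts f (Neg B))"
    then show ?case by (intro NegConjE.IH(3)) (use NegConjE.prems in blast)+
  qed
next
  case (NegDisjI H1 A H2 B)
  have "v (map_consts f (Neg A))" by (rule NegDisjI.IH(1)) (use NegDisjI.prems in auto)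
  moreover have "v (map_consts f (Neg B))" by (rule NegDisjI.IH(2)) (use NegDisjI.prems in auto)
  moreover have "map_consts f (Neg A) \<in> Sent S'" "map_consts f (Neg B) \<in> Sent S'"
    using NegDisjI.hyps NegDisjI.prems(1)
    by (blast intro: Sent_map_consts derivation_Sent[OF sig])+
  ultimately show ?case by (simp add: v_Neg_Disj)
next
  case (NegDisjE1 H A B)
  have "v (map_consts f (Neg (Disj A B)))" by (rule NegDisjE1.IH) (use NegDisjE1.prems in auto)
  moreover have "map_consts f (Neg (Disj A B)) \<in> Sent S'"
    using NegDisjE1.hyps NegDisjE1.prems(1) by (intro Sent_map_consts derivation_Sent[OF sig])
  ultimately show ?case by (simp add: v_Neg_Disj)
next
  case (NegDisjE2 H A B)
  have "v (map_consts f (Neg (Disj A B)))" by (rule NegDisjE2.IH) (use NegDisjE2.prems in auto)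
  moreover have "map_consts f (Neg (Disj A B)) \<in> Sent S'"
    using NegDisjE2.hyps NegDisjE2.prems(1) by (intro Sent_map_consts derivation_Sent[OF sig])
  ultimately show ?case by (simp add: v_Neg_Disj)
next
  case (DNI H A)
  have "v (map_consts f A)" by (rule DNI.IH) (use DNI.prems in auto)
  moreover have "map_consts f A \<in> Sent S'"
    using DNI.hyps DNI.prems(1) by (intro Sent_map_consts derivation_Sent[OF sig])
  ultimately show ?case by (simp add: v_Neg_Neg)
next
  case (DNE H A)
  have "v (map_consts f (Neg (Neg A)))" by (rule DNE.IH) (use DNE.prems in auto)
  moreover have "map_consts f (Neg (Neg A)) \<in> Sent S'"
    using DNE.hyps DNE.prems(1) by (intro Sent_map_consts derivation_Sent[OF sig])
  ultimately show ?case by (simp add: v_Neg_Neg)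
next
  case (EXP H1 A H2 H3 B)
  have "v (map_consts f (Circ A))" by (rule EXP.IH(1)) (use EXP.prems in auto)
  moreover have "v (map_consts f A)" by (rule EXP.IH(2)) (use EXP.prems in auto)
  moreover have "v (map_consts f (Neg A))" by (rule EXP.IH(3)) (use EXP.prems in auto)
  moreover have "map_consts f A \<in> Sent S'"
    using EXP.hyps(2) EXP.prems(1) by (intro Sent_map_consts derivation_Sent[OF sig])
  \<comment> \<open>The three truths contradict \<open>v_CircD\<close>, so \<open>B\<close> may be
    anything.\<close>
  ultimately show ?case using v_CircD by simp
next
  case (PEM H A)
  have "v (map_consts f (Circ A))" by (rule PEM.IH) (use PEM.prems in auto)
  moreover have "map_consts f (Circ A) \<in> Sent S'"
    using PEM.hyps PEM.prems(1) by (intro Sent_map_consts derivation_Sent[OF sig])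
  ultimately show ?case using v_CircD by (auto simp: v_Disj)
next
  case (Cons H1 A H2 B)
  have "v (map_consts f (Circ A))" by (rule Cons.IH(1)) (use Cons.prems in auto)
  moreover have "v (map_consts f (Bullet A))" by (rule Cons.IH(2)) (use Cons.prems in auto)
  moreover have "map_consts f (Circ A) \<in> Sent S'"
    using Cons.hyps(1) Cons.prems(1) by (intro Sent_map_consts derivation_Sent[OF sig])
  ultimately show ?case by (simp add: v_Circ)
next
  case (Comp A)
  then have "map_consts f A \<in> Sent S'" by (intro Sent_map_consts)
  then show ?case by (simp add: v_Disj v_Circ)
next
  case (AllI H B A c x)
  have B: "map_consts f B \<in> Sent S'"
    using derivation_Sent[OF sig AllI.hyps(1)] AllI.prems(1) by (simp add: Sent_map_consts)
  have A: "All x (map_consts f A) \<in> Sent S'"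
    using Sent_map_consts[OF AllI.prems(1) AllI.hyps(2)] by simp
  \<comment> \<open>Freshness of \<open>c\<close> makes the change of \<open>f\<close> at
    \<open>c\<close> invisible in \<open>H\<close>, \<open>A\<close> and \<open>B\<close>; only the
    substituted constant moves, to the name of \<open>a\<close>.\<close>
  have "v (map_consts f B) \<or> v (inst (map_consts f A) (Inr a) x)" if "a \<in> dom \<AA>" for a
  proof -
    have "v (map_consts (f(c := Inr a)) (Disj B (inst A c x)))"
    proof (rule AllI.IH)
      show "f(c := Inr a) ` constants S \<subseteq> constants S'" using AllI.prems(1) that by auto
      show "v (map_consts (f(c := Inr a)) D)" if "D \<in> H" for D
        using AllI.prems(2) AllI.hyps(6) that by (simp add: map_consts_fun_upd)
    qed
    then have "v (Disj (map_consts f B) (inst (map_consts f A) (Inr a) x))"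
      using AllI.hyps(4,5) by (simp add: map_consts_inst map_consts_fun_upd)
    moreover have "inst (map_consts f A) (Inr a) x \<in> Sent S'"
      using Sent_AllD[OF A] that by (intro Sent_inst) auto
    ultimately show ?thesis using B by (simp add: v_Disj)
  qed
  \<comment> \<open>\<open>B\<close> does not depend on \<open>a\<close>: if it fails, every
    instance holds.\<close>
  then show ?case using A B by (auto simp: v_Disj v_All)
next
  case (AllE H x A c)
  have "map_consts f (All x A) \<in> Sent S'"
    using AllE.hyps(1) AllE.prems(1) by (intro Sent_map_consts derivation_Sent[OF sig])
  then have A: "All x (map_consts f A) \<in> Sent S'" by simp
  have c: "f c \<in> constants S'" using AllE.hyps(2) AllE.prems(1) by blast
  have "v (map_consts f (All x A))" by (rule AllE.IH) (use AllE.prems in auto)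
  \<comment> \<open>The clause is used at the denotation of \<open>f c\<close>;
    \<open>v_inst_val\<close> then returns to \<open>f c\<close> itself.\<close>
  then have "v (inst (map_consts f A) (Inr (val (f c))) x)"
    using A val_in_dom[OF c] by (simp add: v_All)
  then show ?case using v_inst_val(1) Sent_AllD[OF A] c by (simp add: map_consts_inst)
next
  case (ExI H A c x)
  have A: "Ex x (map_consts f A) \<in> Sent S'"
    using Sent_map_consts[OF ExI.prems(1) ExI.hyps(2)] by simp
  have c: "f c \<in> constants S'" using ExI.hyps(3) ExI.prems(1) by blast
  have "v (map_consts f (inst A c x))" by (rule ExI.IH) (use ExI.prems in auto)
  then have "v (inst (map_consts f A) (Inr (val (f c))) x)"
    using v_inst_val(1) Sent_ExD[OF A] c by (simp add: map_consts_inst)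
  then show ?case using A val_in_dom[OF c] by (auto simp: v_Ex)
next
  case (ExE H x A H1 C c)
  have "map_consts f (Ex x A) \<in> Sent S'"
    using ExE.hyps(1) ExE.prems(1) by (intro Sent_map_consts derivation_Sent[OF sig])
  then have A: "Ex x (map_consts f A) \<in> Sent S'" by simp
  have "v (map_consts f (Ex x A))" by (rule ExE.IH(1)) (use ExE.prems in auto)
  then obtain a where a: "a \<in> dom \<AA>" "v (inst (map_consts f A) (Inr a) x)"
    using A by (auto simp: v_Ex)
  \<comment> \<open>Naming the witness \<open>a\<close> by \<open>c\<close> makes the discharged
    hypothesis true. Since \<open>c\<close> is absent from \<open>C\<close>, the conclusion carries
    back to \<open>f\<close>.\<close>
  have "v (map_consts (f(c := Inr a)) C)"
  proof (rule ExE.IH(2))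
    show "f(c := Inr a) ` constants S \<subseteq> constants S'" using ExE.prems(1) a(1) by auto
    show "v (map_consts (f(c := Inr a)) D)" if "D \<in> H1" for D
    \<comment> \<open>Only the discharged hypothesis may contain \<open>c\<close>; every other one
      keeps its truth under the altered map.\<close>
    proof (cases "D = inst A c x")
      case True
      then show ?thesis using a(2) ExE.hyps(4) by (simp add: map_consts_inst map_consts_fun_upd)
    next
      case False
      then show ?thesis using ExE.prems(2) ExE.hyps(6) that by (simp add: map_consts_fun_upd)
    qed
  qed
  then show ?case using ExE.hyps(5) by (simp add: map_consts_fun_upd)
next
  case (NegAllI H A c x)
  have A: "All x (map_consts f A) \<in> Sent S'"
    using Sent_map_consts[OF NegAllI.prems(1) NegAllI.hyps(2)] by simp
  have c: "f c \<in> constants S'" using NegAllI.hyps(3) NegAllI.prems(1) by blast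
  have "v (map_consts f (Neg (inst A c x)))" by (rule NegAllI.IH) (use NegAllI.prems in auto)
  then have "v (Neg (inst (map_consts f A) (Inr (val (f c))) x))"
    using v_inst_val(2) Sent_AllD[OF A] c by (simp add: map_consts_inst)
  then show ?case using A val_in_dom[OF c] by (auto simp: v_Neg_All)
next
  case (NegAllE H x A H1 C c)
  have "map_consts f (Neg (All x A)) \<in> Sent S'"
    using NegAllE.hyps(1) NegAllE.prems(1) by (intro Sent_map_consts derivation_Sent[OF sig])
  then have A: "All x (map_consts f A) \<in> Sent S'" by simp
  have "v (map_consts f (Neg (All x A)))" by (rule NegAllE.IH(1)) (use NegAllE.prems in auto)
  then obtain a where a: "a \<in> dom \<AA>" "v (Neg (inst (map_consts f A) (Inr a) x))"
    using A by (auto simp: v_Neg_All)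
  have "v (map_consts (f(c := Inr a)) C)"
  proof (rule NegAllE.IH(2))
    show "f(c := Inr a) ` constants S \<subseteq> constants S'" using NegAllE.prems(1) a(1) by auto
    show "v (map_consts (f(c := Inr a)) D)" if "D \<in> H1" for D
    proof (cases "D = Neg (inst A c x)")
      case True
      then show ?thesis using a(2) NegAllE.hyps(4) by (simp add: map_consts_inst map_consts_fun_upd)
    next
      case False
      then show ?thesis using NegAllE.prems(2) NegAllE.hyps(6) that by (simp add: map_consts_fun_upd)
    qed
  qed
  then show ?case using NegAllE.hyps(5) by (simp add: map_consts_fun_upd)
next
  case (NegExI H A c x)
  have A: "Ex x (map_consts f A) \<in> Sent S'"
    using Sent_map_consts[OF NegExI.prems(1) NegExI.hyps(2)] by simp
  have "v (Neg (inst (map_consts f A) (Inr a) x))" if "a \<in> dom \<AA>" for a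
  proof -
    \<comment> \<open>As in \<open>AllI\<close>, one derivation with fresh \<open>c\<close> serves
      every element \<open>a\<close>.\<close>
    have "v (map_consts (f(c := Inr a)) (Neg (inst A c x)))"
    proof (rule NegExI.IH)
      show "f(c := Inr a) ` constants S \<subseteq> constants S'" using NegExI.prems(1) that by auto
      show "v (map_consts (f(c := Inr a)) D)" if "D \<in> H" for D
        using NegExI.prems(2) NegExI.hyps(5) that by (simp add: map_consts_fun_upd)
    qed
    then show ?thesis using NegExI.hyps(4) by (simp add: map_consts_inst map_consts_fun_upd)
  qed
  then show ?case using A by (simp add: v_Neg_Ex)
next
  case (NegExE H x A c)
  have "map_consts f (Neg (Ex x A)) \<in> Sent S'"
    using NegExE.hyps(1) NegExE.prems(1) by (intro Sent_map_consts derivation_Sent[OF sig])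
  then have A: "Ex x (map_consts f A) \<in> Sent S'" by simp
  have c: "f c \<in> constants S'" using NegExE.hyps(2) NegExE.prems(1) by blast
  have "v (map_consts f (Neg (Ex x A)))" by (rule NegExE.IH) (use NegExE.prems in auto)
  then have "v (Neg (inst (map_consts f A) (Inr (val (f c))) x))"
    using A val_in_dom[OF c] by (simp add: v_Neg_Ex)
  then show ?case using v_inst_val(2) Sent_ExD[OF A] c by (simp add: map_consts_inst)
next
  case (IdI c)
  then have "f c \<in> constants S'" by blast
  then show ?case
    using v_ident[of "f c" "f c"] by simp
next
  case (IdE H1 c1 c2 H2 A x)
  have c: "f c1 \<in> constants S'" "f c2 \<in> constants S'" using IdE.hyps(5,6) IdE.prems(1) by auto
  have "v (map_consts f (Atom (ident S) [Cst c1, Cst c2]))"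
    by (rule IdE.IH(1)) (use IdE.prems in auto)
  then have "val (f c1) = val (f c2)" using v_ident[OF c] by simp
  moreover have "v (map_consts f (inst A c1 x))" by (rule IdE.IH(2)) (use IdE.prems in auto)
  moreover have "is_formula S' (map_consts f A)"
    using IdE.hyps(3) IdE.prems(1) by (simp add: Form_def is_formula_map_consts)
  \<comment> \<open>The identity premise makes \<open>f c1\<close> and \<open>f c2\<close>
    codenoting, hence interchangeable in the replaced \<open>A\<close>.\<close>
  ultimately show ?case
    using v_codenoting[of "map_consts f A" x "f c1" "f c2"] IdE.hyps(4) c
    by (simp add: map_consts_inst)
next
  case (AV H A A')
  have "v (map_consts f A)" by (rule AV.IH) (use AV.prems in auto)
  moreover have "map_consts f A \<in> Sent S'" "map_consts f A' \<in> Sent S'"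
    using AV.hyps AV.prems(1) by (auto intro: Sent_map_consts derivation_Sent[OF sig])
  moreover have "alphabetic_variant (map_consts f A) (map_consts f A')"
    using AV.hyps(2) by (simp add: alphabetic_variant_def fm_match_map_consts)
  ultimately show ?case using v_alphabetic_variant by blast
qed

end

section \<open>From truth preservation to semantic consequence\<close>

theorem theorem12:
  fixes S :: "('c, 'p) signature"
    and \<Gamma> :: "('c, 'p) fm set"
    and A :: "('c, 'p) fm"
  assumes "is_signature S"
    and "\<Gamma> \<union> {A} \<subseteq> Sent S"
    and "provable S \<Gamma> A"
  shows "entails TYPE('d) S \<Gamma> A"
  unfolding entails_def
proof (intro allI impI)
  fix \<AA> :: "('c, 'p, 'd) interp" and v
  assume "is_interpretation S \<AA> v" and \<Gamma>: "\<forall>B\<in>\<Gamma>. satisfies v B"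
  then interpret valued_structure S \<AA> v
    using assms(1) by unfold_locales
  obtain H where "H \<subseteq> \<Gamma>" "derivation S H A"
    using assms(3) by (auto simp: provable_def)
  \<comment> \<open>With \<open>f = Inl\<close>, \<open>map_consts f\<close> is the embedding by
    which \<open>satisfies\<close> is defined.\<close>
  moreover have "Inl ` constants S \<subseteq> constants S'"
    by (simp add: diagram_signature_def)
  ultimately show "satisfies v A"
    using derivation_sound[of H A Inl] \<Gamma> by (auto simp: satisfies_def map_consts_def)
qed

end
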